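(* Consider the robust distributed learning problem and Algorithm A described in the context. Assume: (1) For all $\theta,\theta_1,\theta_2\in\mathbb{R}^p$ and $z,z_1,z_2\in\mathbb{R}^d$: $\|\nabla_\theta f(\theta_1;z)-\nabla_\theta f(\theta_2;z)\|\le L_{\theta\theta}\|\theta_1-\theta_2\|$, $\|\nabla_\theta f(\theta;z_1)-\nabla_\theta f(\theta;z_2)\|\le L_{\theta z}\|z_1-z_2\|$, $\|\nabla_z f(\theta_1;z)-\nabla_z f(\theta_2;z)\|\le L_{z\theta}\|\theta_1-\theta_2\|$, $\|\nabla_z f(\theta;z_1)-\nabla_z f(\theta;z_2)\|\le L_{zz}\|z_1-z_2\|$. (2) For every $x$, the function $z\mapsto c(z,x)$ is $L_c$-smooth and $1$-strongly convex. (3) $\lambda>L_{zz}$. (4) For every iterate $\theta_t$, $\max_{1\le k\le N}\big\|\nabla_\theta f(\theta_t;z_k^*(\theta_t))-\frac1N\sum_{j=1}^N\nabla_\theta f(\theta_t;z_j^*(\theta_t))\big\|\le\sigma$. (5) $f(\theta;z)$ is convex with respect to $\theta$. (6) With $\theta^*$ a global minimizer of $F$, there is a fixed $k$ such that $\|\theta_t-\theta^*\|\le k\|\theta_0-\theta^*\|$ for $t=0,1,\ldots,T-1$. Let $L_F=L_{\theta\theta}+\frac{L_{\theta z}L_{z\theta}}{\lambda-L_{zz}}$, $C_\alpha=\frac{2\alpha}{1-\beta}$, $D=k\|\theta_0-\theta^*\|$, and suppose $\alpha<\frac13$. If Algorithm A is run with $\eta=\frac1{L_F}$, then for every $r$ with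 $0<r<\big(\frac{1-\beta}{2\alpha}\big)^2-1$, $$F(\theta_T)-F(\theta^* )\le\max\left\{\frac{4L_FD^2}{\big(1-(1+r)C_\alpha^2\big)T},\ \sqrt{\frac{2(1+1/r)}{1-(1+r)C_\alpha^2}}\,D(L_{\theta z}\varepsilon+\sigma)+\frac{(1+1/r)(L_{\theta z}\varepsilon+\sigma)^2}{2L_F}\right\}.$$
   Context: $\|\cdot\|$ is the Euclidean norm. A differentiable function is $L$-smooth if its gradient is $L$-Lipschitz. Problem. There are $m$ workers and $N=mn$ data points $x_1,\ldots,x_N\in\mathbb{R}^d$; worker $i$ holds $x_{(i-1)n+1},\ldots,x_{(i-1)n+n}$. $f(\theta;z)$ is a real-valued differentiable loss, $\theta\in\mathbb{R}^p$, $z\in\mathbb{R}^d$; $c(z,x)$ is a real-valued cost on $\mathbb{R}^d\times\mathbb{R}^d$; $\lambda\ge0$ is a fixed constant. Put $\phi_\lambda(\theta;x)=\sup_z\{f(\theta;z)-\lambda c(z,x)\}$ and $F(\theta)=\frac1N\sum_{j=1}^N\phi_\lambda(\theta;x_j)$. Let $z_j^*(\theta)=\arg\sup_z\{f(\theta;z)-\lambda c(z,x_j)\}$ denote the exact maximizer (unique under assumptions (1)-(3)). $\nabla_\theta f(\theta_t;z_j^*(\theta_t))$ denotes the gradient of $f$ in its first argument with the second argument held fixed, evaluated at $(\theta_t,z_j^*(\theta_t))$. The workers are partitioned into byzantine workers $\mathcal{B}$, $|\mathcal{B}|=\alpha m$, and honest workers $\mathcal{M}$, $|\mathcal{M}|=(1-\alpha)m$.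 Norm-based screening. For vectors $g_1,\ldots,g_m$, order indices so that $\|g_{(1)}\|\le\cdots\le\|g_{(m)}\|$ (ties broken arbitrarily), let $\mathcal{U}=\{(1),\ldots,((1-\beta)m)\}$, and set $\mathbf{Norm\_Screen}_\beta(g_1,\ldots,g_m)=\frac1{|\mathcal{U}|}\sum_{i\in\mathcal{U}}g_i$. Algorithm A (inputs: $\beta$ with $\alpha\le\beta<1$, step size $\eta$, initial $\theta_0$, number of iterations $T\ge1$, precision $\varepsilon\ge0$). For $t=0,\ldots,T-1$: for every sample $x_j$ of an honest worker, a point $z_j^\varepsilon(\theta_t)$ with $\|z_j^\varepsilon(\theta_t)-z_j^*(\theta_t)\|\le\varepsilon$ is obtained; each honest worker $i\in\mathcal{M}$ sends $g_i(\theta_t)=\frac1n\sum_{j=(i-1)n+1}^{(i-1)n+n}\nabla_\theta f(\theta_t;z_j^\varepsilon(\theta_t))$; each byzantine worker $i\in\mathcal{B}$ sends an arbitrary vector $g_i(\theta_t)\in\mathbb{R}^p$; the server computes $G(\theta_t)=\mathbf{Norm\_Screen}_\beta(g_1(\theta_t),\ldots,g_m(\theta_t))$ and sets $\theta_{t+1}=\theta_t-\eta\,G(\theta_t)$. Conventions: $\alpha\ge0$; $\alpha m$ and $(1-\beta)m$ are integers; $L_F>0$; if $\alpha=0$ the upper bound on $r$ is read as $+\infty$. *)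

theory Defs
  imports "HOL-Analysis.Analysis"
begin

definition gradient :: "('a::real_inner \<Rightarrow> real) \<Rightarrow> 'a \<Rightarrow> 'a" where
  "gradient h x = (THE D. GDERIV h x :> D)"

definition grad_theta :: "('a::real_inner \<Rightarrow> 'b::real_inner \<Rightarrow> real) \<Rightarrow> 'a \<Rightarrow> 'b \<Rightarrow> 'a" where
  "grad_theta f \<theta> z = gradient (\<lambda>\<theta>'. f \<theta>' z) \<theta>"

definition grad_z :: "('a::real_inner \<Rightarrow> 'b::real_inner \<Rightarrow> real) \<Rightarrow> 'a \<Rightarrow> 'b \<Rightarrow> 'b" where
  "grad_z f \<theta> z = gradient (\<lambda>z'. f \<theta> z') z"

definition smooth_with :: "real \<Rightarrow> ('a::real_inner \<Rightarrow> real) \<Rightarrow> bool" where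
  "smooth_with L h \<longleftrightarrow>
     (\<forall>x. h differentiable at x) \<and> (\<forall>x y. norm (gradient h x - gradient h y) \<le> L * norm (x - y))"

definition strongly_convex :: "real \<Rightarrow> ('a::real_inner \<Rightarrow> real) \<Rightarrow> bool" where
  "strongly_convex \<mu> h \<longleftrightarrow>
     (\<forall>x y. \<forall>s\<in>{0..1}. h (s *\<^sub>R x + (1 - s) *\<^sub>R y)
        \<le> s * h x + (1 - s) * h y - \<mu> / 2 * s * (1 - s) * (norm (x - y))\<^sup>2)"

(* SUP is the supremum of the conditionally complete order of the reals, so phi is meaningful only
   where the objective is bounded above in z; this is the case for lam > L_zz. *)
definition phi ::
  "('a \<Rightarrow> 'b \<Rightarrow> real) \<Rightarrow> ('b \<Rightarrow> 'b \<Rightarrow> real) \<Rightarrow> real \<Rightarrow> 'a \<Rightarrow> 'b \<Rightarrow> real" where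
  "phi f c lam \<theta> x = (SUP z. f \<theta> z - lam * c z x)"

definition robust_loss ::
  "('a \<Rightarrow> 'b \<Rightarrow> real) \<Rightarrow> ('b \<Rightarrow> 'b \<Rightarrow> real) \<Rightarrow> real \<Rightarrow> (nat \<Rightarrow> 'b) \<Rightarrow> nat \<Rightarrow> 'a \<Rightarrow> real" where
  "robust_loss f c lam x N \<theta> = (1 / real N) * (\<Sum>j=1..N. phi f c lam \<theta> (x j))"

(* arg_max chooses some maximizer; for lam > L_zz the maximizer exists and is unique. *)
definition z_star ::
  "('a \<Rightarrow> 'b \<Rightarrow> real) \<Rightarrow> ('b \<Rightarrow> 'b \<Rightarrow> real) \<Rightarrow> real \<Rightarrow> 'a \<Rightarrow> 'b \<Rightarrow> 'b" where
  "z_star f c lam \<theta> x = arg_max (\<lambda>z. f \<theta> z - lam * c z x) (\<lambda>_. True)"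

(* A relation rather than a function: ties in the ordering by norm may be broken in any way, so
   several outputs v can be admissible for the same g. *)
definition norm_screen :: "real \<Rightarrow> nat \<Rightarrow> (nat \<Rightarrow> 'a::real_normed_vector) \<Rightarrow> 'a \<Rightarrow> bool" where
  "norm_screen \<beta> m g v \<longleftrightarrow>
     (\<exists>\<pi> U. bij_betw \<pi> {1..m} {1..m} \<and>
        (\<forall>i\<in>{1..m}. \<forall>j\<in>{1..m}. i \<le> j \<longrightarrow> norm (g (\<pi> i)) \<le> norm (g (\<pi> j))) \<and>
        U = \<pi> ` {i \<in> {1..m}. real i \<le> (1 - \<beta>) * real m} \<and>
        v = (1 / real (card U)) *\<^sub>R (\<Sum>i\<in>U. g i))"

definition samples :: "nat \<Rightarrow> nat \<Rightarrow> nat set" where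
  "samples n i = {(i - 1) * n + 1..(i - 1) * n + n}"

(* ze t j is the approximate maximizer for sample j and g t i the message of worker i, both at
   iteration t. The messages of the workers outside M are unconstrained, and both families may depend
   on the whole history of the run. *)
definition algorithm_A_run ::
  "(real^'p \<Rightarrow> real^'d \<Rightarrow> real) \<Rightarrow> (real^'d \<Rightarrow> real^'d \<Rightarrow> real) \<Rightarrow> real \<Rightarrow> (nat \<Rightarrow> real^'d) \<Rightarrow>
   nat \<Rightarrow> nat \<Rightarrow> nat set \<Rightarrow> real \<Rightarrow> real \<Rightarrow> real \<Rightarrow> nat \<Rightarrow>
   (nat \<Rightarrow> nat \<Rightarrow> real^'d) \<Rightarrow> (nat \<Rightarrow> nat \<Rightarrow> real^'p) \<Rightarrow> (nat \<Rightarrow> real^'p) \<Rightarrow> bool" where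
  "algorithm_A_run f c lam x m n M \<beta> \<eta> \<epsilon> T ze g \<theta> \<longleftrightarrow>
     (\<forall>t<T.
        (\<forall>i\<in>M. \<forall>j\<in>samples n i. norm (ze t j - z_star f c lam (\<theta> t) (x j)) \<le> \<epsilon>) \<and>
        (\<forall>i\<in>M. g t i = (1 / real n) *\<^sub>R (\<Sum>j\<in>samples n i. grad_theta f (\<theta> t) (ze t j))) \<and>
        (\<exists>G. norm_screen \<beta> m (g t) G \<and> \<theta> (Suc t) = \<theta> t - \<eta> *\<^sub>R G))"

end

theory Submission imports Defs begin

text \<open>Each \<open>\<phi>\<close> has the subgradient \<open>\<nabla>\<^sub>\<theta> f (\<theta>; z*(\<theta>))\<close>, and strong concavity of the inner problem makes
  \<open>z*\<close>, hence this subgradient, Lipschitz; a function with a Lipschitz subgradient is smooth, so \<open>F\<close>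
  satisfies the descent inequality with constant \<open>L\<^sub>F\<close>. A byzantine vector surviving the screening is
  no longer than some discarded honest one, so the screened mean differs from \<open>\<nabla>F\<close> by at most
  \<open>C\<^sub>\<alpha> \<parallel>\<nabla>F\<parallel> + L\<^sub>\<theta>\<^sub>z \<epsilon> + \<sigma>\<close>. With \<open>\<parallel>\<nabla>F(\<theta>\<^sub>t)\<parallel> \<ge> (F(\<theta>\<^sub>t) - F(\<theta>*)) / D\<close> from convexity, the
  suboptimality obeys \<open>u\<^sub>t\<^sub>+\<^sub>1 \<le> u\<^sub>t - a u\<^sub>t\<^sup>2 + e\<close> with constants \<open>a\<close>, \<open>e\<close>, which gives the stated bound.\<close>

section \<open>Gradients, smoothness and first-order inequalities\<close>

lemma gderiv_gradient:
  fixes h :: "'a::euclidean_space \<Rightarrow> real"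
  assumes "h differentiable at x"
  shows "GDERIV h x :> gradient h x"
proof -
  obtain h' where h': "(h has_derivative h') (at x)"
    using assms unfolding differentiable_def by blast
  then interpret bounded_linear h' by (rule has_derivative_bounded_linear)
  \<comment> \<open>The Riesz representer of the derivative, written in the orthonormal basis; its
    uniqueness, shown next, is what makes the \<open>THE\<close> in \<open>gradient\<close>
    meaningful.\<close>
  define D where "D = (\<Sum>b\<in>Basis. h' b *\<^sub>R b)"
  have "h' y = y \<bullet> D" for y
  proof -
    have "h' y = h' (\<Sum>b\<in>Basis. (y \<bullet> b) *\<^sub>R b)"
      by (simp add: euclidean_representation)
    also have "\<dots> = y \<bullet> D"
      by (simp add: D_def sum scaleR inner_sum_right mult.commute)
    finally show ?thesis .
  qed
  then have "h' = (\<lambda>y. y \<bullet> D)" by blast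
  with h' have "GDERIV h x :> D" by (simp add: gderiv_def)
  moreover from this have "gradient h x = D"
    unfolding gradient_def
  proof (rule the_equality)
    fix E assume "GDERIV h x :> E"
    then have "(\<lambda>y. y \<bullet> E) = (\<lambda>y. y \<bullet> D)"
      using \<open>GDERIV h x :> D\<close> unfolding gderiv_def by (rule has_derivative_unique)
    then have "y \<bullet> E = y \<bullet> D" for y by meson
    then have "(E - D) \<bullet> (E - D) = 0" by (simp add: inner_diff_right)
    then show "E = D" by simp
  qed
  ultimately show ?thesis by simp
qed

lemma gderiv_along_line:
  assumes "GDERIV h (x + s *\<^sub>R d) :> D"
  shows "((\<lambda>s. h (x + s *\<^sub>R d)) has_real_derivative D \<bullet> d) (at s)"
proof -
  have "((\<lambda>s. x + s *\<^sub>R d) has_derivative (\<lambda>t. t *\<^sub>R d)) (at s)"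
    by (auto intro!: derivative_eq_intros)
  from has_derivative_compose[OF this assms[unfolded gderiv_def]]
  show ?thesis
    by (simp add: has_field_derivative_def inner_commute mult_commute_abs)
qed

text \<open>A basis vector and the origin lie at distance one, so the constant itself bounds a norm.
  This recovers the signs of Lipschitz constants, which are later multiplied into
  inequalities.\<close>

lemma lipschitz_const_nonneg:
  fixes v :: "'a::euclidean_space \<Rightarrow> 'b::real_normed_vector"
  assumes "\<And>x y. norm (v x - v y) \<le> L * norm (x - y)"
  shows "0 \<le> L"
proof -
  obtain b :: 'a where "b \<in> Basis" using nonempty_Basis by blast
  have "0 \<le> norm (v b - v 0)" by simp
  also have "\<dots> \<le> L * norm (b - 0)" by (rule assms)
  also have "\<dots> = L" using \<open>b \<in> Basis\<close> by simp
  finally show ?thesis .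
qed

lemma descent_lemma:
  fixes h :: "'a::real_inner \<Rightarrow> real"
  assumes deriv: "\<And>x. GDERIV h x :> v x"
    and lip: "\<And>x y. norm (v x - v y) \<le> L * norm (x - y)"
  shows "h y \<le> h x + v x \<bullet> (y - x) + L / 2 * (norm (y - x))\<^sup>2"
proof -
  define d where "d = y - x"
  \<comment> \<open>The quadratic upper model minus \<open>h\<close> along the segment, up to the
    constant \<open>h x\<close>. Monotonicity of \<open>w\<close> on [0,1] replaces integration of
    the gradient.\<close>
  define w where "w s = s * (v x \<bullet> d) + L / 2 * s\<^sup>2 * (norm d)\<^sup>2 - h (x + s *\<^sub>R d)" for s
  have "w 0 \<le> w 1"
  proof (rule DERIV_nonneg_imp_nondecreasing[of 0 1 w])
    fix s :: real assume "0 \<le> s"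
    have "((\<lambda>s. h (x + s *\<^sub>R d)) has_real_derivative v (x + s *\<^sub>R d) \<bullet> d) (at s)"
      by (rule gderiv_along_line) (rule deriv)
    then have "(w has_real_derivative
        v x \<bullet> d + L * s * (norm d)\<^sup>2 - v (x + s *\<^sub>R d) \<bullet> d) (at s)"
      unfolding w_def
      by (auto intro!: derivative_eq_intros)
    moreover have "(v (x + s *\<^sub>R d) - v x) \<bullet> d \<le> L * s * (norm d)\<^sup>2"
    proof -
      have "(v (x + s *\<^sub>R d) - v x) \<bullet> d \<le> norm (v (x + s *\<^sub>R d) - v x) * norm d"
        by (rule norm_cauchy_schwarz)
      also have "\<dots> \<le> (L * norm (x + s *\<^sub>R d - x)) * norm d"
        by (intro mult_right_mono lip) auto
      also have "\<dots> = L * s * (norm d)\<^sup>2"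
        using \<open>0 \<le> s\<close> by (simp add: power2_eq_square)
      finally show ?thesis .
    qed
    ultimately show "\<exists>w'. (w has_real_derivative w') (at s) \<and> 0 \<le> w'"
      by (intro exI conjI) (auto simp: inner_diff_left)
  qed simp
  then show ?thesis by (simp add: w_def d_def)
qed

text \<open>Strong convexity between \<open>x\<close> and \<open>y\<close>, divided by
  \<open>s\<close>, bounds the difference quotient at \<open>x\<close>; the claim is its limit as
  \<open>s\<close> tends to 0 from the right.\<close>

lemma strongly_convex_gradient_ineq:
  fixes h :: "'a::real_inner \<Rightarrow> real"
  assumes sc: "strongly_convex \<mu> h" and deriv: "GDERIV h x :> D"
  shows "h x + D \<bullet> (y - x) + \<mu> / 2 * (norm (y - x))\<^sup>2 \<le> h y"
proof -
  have "((\<lambda>s. h (x + s *\<^sub>R (y - x))) has_real_derivative D \<bullet> (y - x)) (at 0)"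
    by (rule gderiv_along_line) (use deriv in simp)
  then have "((\<lambda>s. (h (x + s *\<^sub>R (y - x)) - h x) / s) \<longlongrightarrow> D \<bullet> (y - x)) (at 0)"
    by (simp add: DERIV_def)
  then have lim: "((\<lambda>s. (h (x + s *\<^sub>R (y - x)) - h x) / s) \<longlongrightarrow> D \<bullet> (y - x)) (at_right 0)"
    by (rule filterlim_mono) (auto simp: at_le)
  have "((\<lambda>s. h y - h x - \<mu> / 2 * (1 - s) * (norm (y - x))\<^sup>2) \<longlongrightarrow>
      h y - h x - \<mu> / 2 * (1 - 0) * (norm (y - x))\<^sup>2) (at_right 0)"
    by (intro tendsto_intros)
  moreover have "\<forall>\<^sub>F s in at_right 0. (h (x + s *\<^sub>R (y - x)) - h x) / s
      \<le> h y - h x - \<mu> / 2 * (1 - s) * (norm (y - x))\<^sup>2"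
    unfolding eventually_at_right_field
  proof (intro exI[of _ 1] conjI allI impI)
    fix s :: real assume s: "0 < s" "s < 1"
    then have "h (s *\<^sub>R y + (1 - s) *\<^sub>R x)
        \<le> s * h y + (1 - s) * h x - \<mu> / 2 * s * (1 - s) * (norm (y - x))\<^sup>2"
      using sc unfolding strongly_convex_def by auto
    also have "s *\<^sub>R y + (1 - s) *\<^sub>R x = x + s *\<^sub>R (y - x)"
      by (simp add: algebra_simps)
    finally show "(h (x + s *\<^sub>R (y - x)) - h x) / s
      \<le> h y - h x - \<mu> / 2 * (1 - s) * (norm (y - x))\<^sup>2"
      using s by (simp add: field_simps)
  qed simp
  ultimately have "D \<bullet> (y - x) \<le> h y - h x - \<mu> / 2 * (1 - 0) * (norm (y - x))\<^sup>2"
    using lim by (intro tendsto_le[of "at_right 0"]) auto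
  then show ?thesis by simp
qed

text \<open>Lets the preceding inequality serve both the cost and the merely convex loss.\<close>

lemma convex_on_imp_strongly_convex_0:
  fixes h :: "'a::real_inner \<Rightarrow> real"
  assumes "convex_on UNIV h"
  shows "strongly_convex 0 h"
  unfolding strongly_convex_def
proof (intro allI ballI)
  fix x y and s :: real assume "s \<in> {0..1}"
  then show "h (s *\<^sub>R x + (1 - s) *\<^sub>R y)
      \<le> s * h x + (1 - s) * h y - 0 / 2 * s * (1 - s) * (norm (x - y))\<^sup>2"
    using convex_onD[OF assms, of "1 - s" x y] by simp
qed

text \<open>The subgradient inequality at \<open>x\<close> makes the linearization error
  nonnegative; the one at \<open>x + d\<close> bounds it by
  \<open>(v (x + d) - v x) \<bullet> d\<close>, which the Lipschitz condition makes quadratic in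
  \<open>d\<close>.\<close>

lemma gderiv_lipschitz_subgradient:
  fixes h :: "'a::real_inner \<Rightarrow> real"
  assumes sub: "\<And>x y. h x + v x \<bullet> (y - x) \<le> h y"
    and lip: "\<And>x y. norm (v x - v y) \<le> L * norm (x - y)"
  shows "GDERIV h x :> v x"
  unfolding gderiv_def has_derivative_at
proof (intro conjI bounded_linear_inner_left)
  show "((\<lambda>d. norm (h (x + d) - h x - d \<bullet> v x) / norm d) \<longlongrightarrow> 0) (at 0)"
  proof (rule tendsto_sandwich[where f = "\<lambda>_. 0" and h = "\<lambda>d. L * norm d"])
    show "\<forall>\<^sub>F d in at 0. norm (h (x + d) - h x - d \<bullet> v x) / norm d \<le> L * norm d"
    proof (rule always_eventually, rule allI)
      fix d
      have "0 \<le> h (x + d) - h x - d \<bullet> v x"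
        using sub[of x "x + d"] by (simp add: inner_commute)
      moreover have "h (x + d) - h x - d \<bullet> v x \<le> (v (x + d) - v x) \<bullet> d"
        using sub[of "x + d" x] by (simp add: inner_commute inner_diff_left inner_diff_right)
      moreover have "(v (x + d) - v x) \<bullet> d \<le> norm (v (x + d) - v x) * norm d"
        by (rule norm_cauchy_schwarz)
      moreover have "norm (v (x + d) - v x) * norm d \<le> L * norm d * norm d"
        using lip[of "x + d" x] by (intro mult_right_mono) auto
      ultimately have "norm (h (x + d) - h x - d \<bullet> v x) \<le> L * norm d * norm d"
        unfolding real_norm_def by linarith
      then show "norm (h (x + d) - h x - d \<bullet> v x) / norm d \<le> L * norm d"
        by (cases "d = 0") (simp_all add: divide_le_eq)
    qed
    show "((\<lambda>d. L * norm d) \<longlongrightarrow> 0) (at 0)"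
      by (auto intro!: tendsto_eq_intros)
  qed auto
qed

section \<open>Maximizing a smooth function minus a strongly convex penalty\<close>

context
  fixes a b :: "'b::euclidean_space \<Rightarrow> real" and a' b' :: "'b \<Rightarrow> 'b" and L lam :: real
  assumes a: "\<And>z. GDERIV a z :> a' z"
    and a_lip: "\<And>y z. norm (a' y - a' z) \<le> L * norm (y - z)"
    and b: "\<And>z. GDERIV b z :> b' z"
    and b_sc: "strongly_convex 1 b"
    and lam: "L < lam"
begin

text \<open>The penalty contributes curvature \<open>lam\<close> and \<open>a\<close> can cancel at
  most \<open>L\<close> of it, so the objective is strongly concave with modulus
  \<open>lam - L\<close>.\<close>

lemma penalized_upper_bound:
  "a y - lam * b y \<le> a z - lam * b z + (a' z - lam *\<^sub>R b' z) \<bullet> (y - z)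
     - (lam - L) / 2 * (norm (y - z))\<^sup>2"
proof -
  have "a y \<le> a z + a' z \<bullet> (y - z) + L / 2 * (norm (y - z))\<^sup>2"
    by (rule descent_lemma[OF a a_lip])
  moreover have "0 \<le> lam"
    using lipschitz_const_nonneg[OF a_lip] lam by linarith
  then have "lam * (b z + b' z \<bullet> (y - z) + 1 / 2 * (norm (y - z))\<^sup>2) \<le> lam * b y"
    by (intro mult_left_mono strongly_convex_gradient_ineq[OF b_sc b])
  ultimately show ?thesis
    by (simp add: field_simps inner_diff_left inner_diff_right)
qed

lemma penalized_max_exists: "\<exists>z. \<forall>y. a y - lam * b y \<le> a z - lam * b z"
proof -
  let ?u = "\<lambda>z. a z - lam * b z"
  define w where "w = a' 0 - lam *\<^sub>R b' 0"
  \<comment> \<open>Beyond this radius the quadratic loss in the upper bound at 0 outweighs the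
    linear gain \<open>w \<bullet> y\<close>, so a maximum over the compact ball is global.\<close>
  define R where "R = 2 * norm w / (lam - L)"
  have "continuous_on UNIV a" "continuous_on UNIV b"
    using a b unfolding gderiv_def
    by (auto intro!: continuous_at_imp_continuous_on has_derivative_continuous)
  then have "continuous_on (cball 0 R) ?u"
    by (intro continuous_intros) (auto intro: continuous_on_subset)
  moreover have "0 \<le> R" using lam by (simp add: R_def)
  ultimately obtain z where z: "z \<in> cball 0 R" "\<And>y. y \<in> cball 0 R \<Longrightarrow> ?u y \<le> ?u z"
    using continuous_attains_sup[of "cball 0 R" ?u] by auto
  have "?u y \<le> ?u z" for y
  proof (cases "norm y \<le> R")
    case False
    then have "norm w \<le> (lam - L) / 2 * norm y"
      using lam by (simp add: R_def field_simps)
    then have "norm w * norm y \<le> (lam - L) / 2 * norm y * norm y"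
      by (rule mult_right_mono) simp
    moreover have "w \<bullet> y \<le> norm w * norm y" by (rule norm_cauchy_schwarz)
    moreover have "?u y \<le> ?u 0 + w \<bullet> y - (lam - L) / 2 * (norm y)\<^sup>2"
      using penalized_upper_bound[of y 0] by (simp add: w_def)
    ultimately have "?u y \<le> ?u 0" by (simp add: power2_eq_square)
    also have "\<dots> \<le> ?u z" using \<open>0 \<le> R\<close> by (intro z) simp
    finally show ?thesis .
  qed (use z in simp)
  then show ?thesis by blast
qed

lemma penalized_max_stationary:
  assumes "\<And>y. a y - lam * b y \<le> a z - lam * b z"
  shows "a' z = lam *\<^sub>R b' z"
proof -
  have "((\<lambda>y. a y - lam * b y) has_derivative (\<lambda>d. d \<bullet> a' z - lam * (d \<bullet> b' z))) (at z)"
    using a[of z] b[of z] unfolding gderiv_def by (intro derivative_intros)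
  from differential_zero_maxmin[OF _ open_UNIV this]
  have "(\<lambda>d. d \<bullet> a' z - lam * (d \<bullet> b' z)) = (\<lambda>d. 0)"
    using assms by auto
  then have "d \<bullet> (a' z - lam *\<^sub>R b' z) = 0" for d
    by (simp add: inner_diff_right fun_eq_iff)
  then have "(a' z - lam *\<^sub>R b' z) \<bullet> (a' z - lam *\<^sub>R b' z) = 0" .
  then show ?thesis by simp
qed

text \<open>Add the upper bounds at \<open>z\<close>, where the gradient vanishes, and at
  \<open>y\<close>: the values cancel and the two quadratic terms remain. It is used with
  \<open>y\<close> the maximizer of a perturbed objective.\<close>

lemma penalized_max_distance:
  assumes "\<And>y. a y - lam * b y \<le> a z - lam * b z"
  shows "(lam - L) * norm (z - y) \<le> norm (a' y - lam *\<^sub>R b' y)"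
proof (cases "z = y")
  case False
  have "a y - lam * b y \<le> a z - lam * b z - (lam - L) / 2 * (norm (z - y))\<^sup>2"
    using penalized_upper_bound[of y z] penalized_max_stationary[OF assms]
    by (simp add: norm_minus_commute)
  then have "(lam - L) * norm (z - y) * norm (z - y) \<le> (a' y - lam *\<^sub>R b' y) \<bullet> (z - y)"
    using penalized_upper_bound[of z y] by (simp add: power2_eq_square)
  also have "\<dots> \<le> norm (a' y - lam *\<^sub>R b' y) * norm (z - y)"
    by (rule norm_cauchy_schwarz)
  finally show ?thesis using False by simp
qed simp

end

section \<open>Accuracy of norm-based screening\<close>

lemma norm_screen_deviation:
  fixes g :: "nat \<Rightarrow> 'a::real_normed_vector"
  assumes screen: "norm_screen \<beta> m g G"
    and m: "1 \<le> m" and \<beta>: "0 \<le> \<alpha>" "\<alpha> \<le> \<beta>" "\<beta> < 1" "(1 - \<beta>) * real m \<in> \<int>"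
    and workers: "B \<union> M = {1..m}" "B \<inter> M = {}"
      "real (card B) = \<alpha> * real m" "real (card M) = (1 - \<alpha>) * real m"
    and honest: "\<And>i. i \<in> M \<Longrightarrow> norm (g i - v) \<le> \<delta>"
    and "0 \<le> \<delta>"
  shows "norm (G - v) \<le> 2 * \<alpha> / (1 - \<beta>) * norm v + \<delta>"
proof -
  obtain \<pi> U where \<pi>: "bij_betw \<pi> {1..m} {1..m}"
    and mono: "\<And>i j. i \<in> {1..m} \<Longrightarrow> j \<in> {1..m} \<Longrightarrow> i \<le> j \<Longrightarrow> norm (g (\<pi> i)) \<le> norm (g (\<pi> j))"
    and U: "U = \<pi> ` {i \<in> {1..m}. real i \<le> (1 - \<beta>) * real m}"
    and G: "G = (1 / real (card U)) *\<^sub>R (\<Sum>i\<in>U. g i)"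
    using screen unfolding norm_screen_def by blast
  obtain l where l: "(1 - \<beta>) * real m = of_int l" using \<beta>(4) by (auto elim: Ints_cases)
  have pos: "0 < (1 - \<beta>) * real m" using m \<beta> by simp
  define K where "K = nat l"
  have K: "(1 - \<beta>) * real m = real K" using pos l unfolding K_def by simp
  have "0 < K" using pos K by simp
  have "(1 - \<beta>) * real m \<le> 1 * real m" using \<beta> by (intro mult_right_mono) auto
  then have "K \<le> m" using K by simp
  then have "{i \<in> {1..m}. real i \<le> (1 - \<beta>) * real m} = {1..K}" unfolding K by auto
  then have U: "U = \<pi> ` {1..K}" using U by simp
  have "inj_on \<pi> {1..K}"
    using \<pi> \<open>K \<le> m\<close> by (auto simp: bij_betw_def intro: inj_on_subset)
  then have card_U: "card U = K" by (simp add: U card_image)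
  have finU: "finite U" by (simp add: U)
  have fin: "finite B" "finite M" using workers(1) finite_Un[of B M] by auto
  have U_sub: "U \<subseteq> B \<union> M"
    using \<pi> \<open>K \<le> m\<close> by (auto simp: U workers(1) bij_betw_def)
  have "(1 - \<beta>) * real m \<le> (1 - \<alpha>) * real m" using \<beta> by (intro mult_right_mono) auto
  then have "K \<le> card M" using K workers(4) by simp
  have bound: "norm (g i - v) \<le> \<delta> + (if i \<in> B then 2 * norm v else 0)" if "i \<in> U" for i
  proof (cases "i \<in> B")
    case True
    \<comment> \<open>Since \<open>\<alpha> \<le> \<beta>\<close>, at most \<open>card M\<close>
      vectors are kept; keeping a byzantine one therefore forces out an honest \<open>j\<close>,
      whose norm then dominates that of \<open>g i\<close>.\<close>
    have "\<not> M \<subseteq> U"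
    proof
      assume "M \<subseteq> U"
      moreover have "i \<notin> M" using True workers(2) by blast
      ultimately have "M \<subset> U" using \<open>i \<in> U\<close> by blast
      then have "card M < card U" using finU by (rule psubset_card_mono[rotated])
      with \<open>K \<le> card M\<close> card_U show False by simp
    qed
    then obtain j where j: "j \<in> M" "j \<notin> U" by blast
    then have "j \<in> \<pi> ` {1..m}" using \<pi> workers(1) by (auto simp: bij_betw_def)
    then obtain q where q: "q \<in> {1..m}" "j = \<pi> q" by blast
    obtain p where p: "p \<in> {1..K}" "i = \<pi> p" using \<open>i \<in> U\<close> U by blast
    have "K < q" using q j(2) U by (force simp: not_less)
    then have "norm (g i) \<le> norm (g j)"
      using mono[of p q] p q \<open>K \<le> m\<close> by auto
    also have "\<dots> \<le> norm (g j - v) + norm v" by (metis diff_add_cancel norm_triangle_ineq)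
    also have "\<dots> \<le> \<delta> + norm v" using honest[OF j(1)] by simp
    finally show ?thesis using norm_triangle_ineq4[of "g i" v] True by simp
  next
    case False
    then show ?thesis using honest[of i] U_sub \<open>i \<in> U\<close> by auto
  qed
  have "G - v = (1 / real K) *\<^sub>R (\<Sum>i\<in>U. g i - v)"
    using \<open>0 < K\<close>
    by (simp add: G card_U sum_subtractf scaleR_diff_right sum_constant_scaleR del: sum_constant)
  then have "norm (G - v) = norm (\<Sum>i\<in>U. g i - v) / real K" by simp
  also have "\<dots> \<le> (\<Sum>i\<in>U. \<delta> + (if i \<in> B then 2 * norm v else 0)) / real K"
    by (intro divide_right_mono sum_norm_le bound) auto
  also have "(\<Sum>i\<in>U. \<delta> + (if i \<in> B then 2 * norm v else 0))
      = real K * \<delta> + real (card (U \<inter> B)) * (2 * norm v)"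
    using finU by (simp add: sum.distrib card_U sum.If_cases)
  \<comment> \<open>At most \<open>\<alpha> * m\<close> kept vectors carry the extra
    \<open>2 * norm v\<close>; division by \<open>K = (1 - \<beta>) * m\<close> turns this into the
    factor \<open>2 * \<alpha> / (1 - \<beta>)\<close>.\<close>
  also have "\<dots> \<le> real K * \<delta> + (\<alpha> * real m) * (2 * norm v)"
    using fin unfolding workers(3)[symmetric]
    by (intro add_left_mono mult_right_mono of_nat_mono card_mono) auto
  also have "(real K * \<delta> + (\<alpha> * real m) * (2 * norm v)) / real K
      = 2 * \<alpha> / (1 - \<beta>) * norm v + \<delta>"
    using m \<beta> unfolding K[symmetric] by (simp add: field_simps)
  finally show ?thesis by (simp add: divide_right_mono)
qed

section \<open>A recursion with quadratic decrease and constant perturbation\<close>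

text \<open>The threshold \<open>s\<close> makes the quadratic decrease at least twice the perturbation \<open>e\<close>: above \<open>s\<close>
  the reciprocals grow by \<open>a / 2\<close> per step, and once below \<open>s\<close> the sequence cannot exceed \<open>s + e\<close>.\<close>

lemma perturbed_quadratic_recursion:
  fixes u :: "nat \<Rightarrow> real"
  assumes step: "\<And>t. t < T \<Longrightarrow> u (Suc t) \<le> u t - a * (u t)\<^sup>2 + e"
    and "1 \<le> T" "0 < a" "0 \<le> e" "0 \<le> s" and s: "a * s\<^sup>2 = 2 * e"
  shows "u T \<le> max (2 / (a * real T)) (s + e)"
proof -
  have above: "u (Suc t) \<le> u t - a / 2 * (u t)\<^sup>2" if "t < T" "s < u t" for t
  proof -
    have "s\<^sup>2 \<le> (u t)\<^sup>2" using that \<open>0 \<le> s\<close> by (intro power_mono) auto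
    then have "a * s\<^sup>2 \<le> a * (u t)\<^sup>2" using \<open>0 < a\<close> by simp
    with s step[OF \<open>t < T\<close>] show ?thesis by simp
  qed
  show ?thesis
  proof (cases "\<exists>t0<T. u t0 \<le> s")
    case True
    then obtain t0 where t0: "t0 < T" "u t0 \<le> s" by blast
    have "u t \<le> s + e" if "t0 \<le> t" "t \<le> T" for t
      using that
    proof (induction t rule: dec_induct)
      case base
      then show ?case using t0 \<open>0 \<le> e\<close> by simp
    next
      case (step t)
      show ?case
      proof (cases "u t \<le> s")
        case True
        moreover have "0 \<le> a * (u t)\<^sup>2" using \<open>0 < a\<close> by simp
        ultimately show ?thesis using assms(1)[of t] step by linarith
      next
        case False
        moreover have "0 \<le> a / 2 * (u t)\<^sup>2" using \<open>0 < a\<close> by simp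
        ultimately show ?thesis using above[of t] step by force
      qed
    qed
    from this[of T] t0 show ?thesis by simp
  next
    case False
    show ?thesis
    \<comment> \<open>Only the terms before \<open>T\<close> are known to exceed \<open>s\<close>;
      the last one needs its own sign check before reciprocals are taken.\<close>
    proof (cases "0 < u T")
      case True
      have pos: "0 < u t" if "t \<le> T" for t
        using that False True \<open>0 \<le> s\<close> by (cases "t = T") (auto simp: not_le intro: le_less_trans)
      have "a / 2 * real t \<le> 1 / u t" if "t \<le> T" for t
        using that
      proof (induction t)
        case 0
        then show ?case using pos[of 0] by simp
      next
        case (Suc t)
        have u: "0 < u t" "0 < u (Suc t)" using pos[of t] pos[of "Suc t"] Suc.prems by auto
        have le: "u (Suc t) \<le> u t - a / 2 * (u t)\<^sup>2" using above[of t] False Suc.prems by (simp add: not_le)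
        have "0 \<le> a / 2 * (u t)\<^sup>2" using \<open>0 < a\<close> by simp
        then have "u (Suc t) \<le> u t" using le by linarith
        \<comment> \<open>As the sequence decreases, the product of neighbours is at most
          \<open>(u t)\<^sup>2\<close>; dividing by that product turns the decrease into a gain of
          \<open>a / 2\<close> in the reciprocal.\<close>
        then have "a / 2 * (u t * u (Suc t)) \<le> a / 2 * (u t)\<^sup>2"
          using u \<open>0 < a\<close> unfolding power2_eq_square by (intro mult_left_mono) auto
        also have "\<dots> \<le> u t - u (Suc t)" using le by simp
        finally have "a / 2 \<le> (u t - u (Suc t)) / (u t * u (Suc t))"
          using u by (subst pos_le_divide_eq) auto
        also have "\<dots> = 1 / u (Suc t) - 1 / u t" using u by (simp add: field_simps)
        finally show ?case using Suc by (simp add: algebra_simps)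
      qed
      from this[of T] have "a * real T * u T \<le> 2" using True by (simp add: field_simps)
      then have "u T \<le> 2 / (a * real T)"
        using \<open>0 < a\<close> \<open>1 \<le> T\<close> by (subst pos_le_divide_eq) (auto simp: mult.commute)
      then show ?thesis by simp
    next
      case False
      then show ?thesis using \<open>0 \<le> s\<close> \<open>0 \<le> e\<close> by (simp add: le_max_iff_disj)
    qed
  qed
qed

section \<open>Regularity of the robust objective\<close>

context
  fixes f :: "'a::euclidean_space \<Rightarrow> 'b::euclidean_space \<Rightarrow> real"
    and c :: "'b \<Rightarrow> 'b \<Rightarrow> real" and lam L\<theta>\<theta> L\<theta>z Lz\<theta> Lzz Lc :: real
  assumes f_diff: "\<And>\<theta> z. (\<lambda>(\<theta>, z). f \<theta> z) differentiable at (\<theta>, z)"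
    and lip_theta_theta: "\<And>\<theta>1 \<theta>2 z.
      norm (grad_theta f \<theta>1 z - grad_theta f \<theta>2 z) \<le> L\<theta>\<theta> * norm (\<theta>1 - \<theta>2)"
    and lip_theta_z: "\<And>\<theta> z1 z2.
      norm (grad_theta f \<theta> z1 - grad_theta f \<theta> z2) \<le> L\<theta>z * norm (z1 - z2)"
    and lip_z_theta: "\<And>\<theta>1 \<theta>2 z.
      norm (grad_z f \<theta>1 z - grad_z f \<theta>2 z) \<le> Lz\<theta> * norm (\<theta>1 - \<theta>2)"
    and lip_z_z: "\<And>\<theta> z1 z2.
      norm (grad_z f \<theta> z1 - grad_z f \<theta> z2) \<le> Lzz * norm (z1 - z2)"
    and cost_smooth: "\<And>y. smooth_with Lc (\<lambda>z. c z y)"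
    and cost_strongly_convex: "\<And>y. strongly_convex 1 (\<lambda>z. c z y)"
    and lam_large: "Lzz < lam"
begin

lemma gderiv_grad_theta: "GDERIV (\<lambda>\<theta>. f \<theta> z) \<theta> :> grad_theta f \<theta> z"
  unfolding grad_theta_def
proof (rule gderiv_gradient)
  have "(\<lambda>\<theta>. (\<theta>, z)) differentiable at \<theta>"
    unfolding differentiable_def by (auto intro!: derivative_eq_intros)
  from differentiable_chain_at[OF this f_diff]
  show "(\<lambda>\<theta>. f \<theta> z) differentiable at \<theta>" by (simp add: o_def)
qed

lemma gderiv_grad_z: "GDERIV (f \<theta>) z :> grad_z f \<theta> z"
  unfolding grad_z_def
proof (rule gderiv_gradient)
  have "(\<lambda>z. (\<theta>, z)) differentiable at z"
    unfolding differentiable_def by (auto intro!: derivative_eq_intros)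
  from differentiable_chain_at[OF this f_diff]
  show "f \<theta> differentiable at z" by (simp add: o_def)
qed

lemma gderiv_cost: "GDERIV (\<lambda>z. c z y) z :> gradient (\<lambda>z. c z y) z"
  using cost_smooth[of y] by (intro gderiv_gradient) (simp add: smooth_with_def)

lemmas penalized_facts = gderiv_grad_z lip_z_z gderiv_cost cost_strongly_convex lam_large

lemma z_star_max:
  "f \<theta> y - lam * c y w \<le> f \<theta> (z_star f c lam \<theta> w) - lam * c (z_star f c lam \<theta> w) w"
proof -
  obtain z where "\<And>y. f \<theta> y - lam * c y w \<le> f \<theta> z - lam * c z w"
    using penalized_max_exists[OF penalized_facts] by blast
  then have "is_arg_max (\<lambda>z. f \<theta> z - lam * c z w) (\<lambda>_. True) z"
    by (simp add: is_arg_max_def not_less)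
  \<comment> \<open>\<open>arg_max\<close> is a Hilbert choice, so the existence of a maximizer must
    come first.\<close>
  then have "is_arg_max (\<lambda>z. f \<theta> z - lam * c z w) (\<lambda>_. True) (z_star f c lam \<theta> w)"
    unfolding z_star_def arg_max_def by (rule someI)
  then show ?thesis by (simp add: is_arg_max_def not_less)
qed

lemma phi_eq_z_star:
  "phi f c lam \<theta> w = f \<theta> (z_star f c lam \<theta> w) - lam * c (z_star f c lam \<theta> w) w"
  unfolding phi_def by (rule cSup_eq_maximum) (auto intro: z_star_max)

text \<open>Stationarity of \<open>?z2\<close> for \<open>\<theta>2\<close> replaces the penalty
  gradient by \<open>grad_z f \<theta>2 ?z2\<close>, so the residual of \<open>?z2\<close> in the
  problem for \<open>\<theta>1\<close> comes only from the change of
  \<open>\<theta>\<close>.\<close>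

lemma z_star_lipschitz:
  "norm (z_star f c lam \<theta>1 w - z_star f c lam \<theta>2 w) \<le> Lz\<theta> / (lam - Lzz) * norm (\<theta>1 - \<theta>2)"
proof -
  let ?z1 = "z_star f c lam \<theta>1 w" and ?z2 = "z_star f c lam \<theta>2 w"
  have "(lam - Lzz) * norm (?z1 - ?z2)
      \<le> norm (grad_z f \<theta>1 ?z2 - lam *\<^sub>R gradient (\<lambda>z. c z w) ?z2)"
    by (rule penalized_max_distance[OF penalized_facts z_star_max])
  also have "lam *\<^sub>R gradient (\<lambda>z. c z w) ?z2 = grad_z f \<theta>2 ?z2"
    by (rule penalized_max_stationary[OF penalized_facts z_star_max, symmetric])
  also have "norm (grad_z f \<theta>1 ?z2 - grad_z f \<theta>2 ?z2) \<le> Lz\<theta> * norm (\<theta>1 - \<theta>2)"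
    by (rule lip_z_theta)
  finally show ?thesis using lam_large by (simp add: field_simps)
qed

text \<open>The triangle inequality passes through \<open>(\<theta>2, ?z1)\<close>: the direct
  change of \<open>\<theta>\<close> gives the first summand of the constant, the induced motion of
  the maximizer the second.\<close>

lemma grad_at_z_star_lipschitz:
  "norm (grad_theta f \<theta>1 (z_star f c lam \<theta>1 w) - grad_theta f \<theta>2 (z_star f c lam \<theta>2 w))
     \<le> (L\<theta>\<theta> + L\<theta>z * Lz\<theta> / (lam - Lzz)) * norm (\<theta>1 - \<theta>2)"
proof -
  let ?z1 = "z_star f c lam \<theta>1 w" and ?z2 = "z_star f c lam \<theta>2 w"
  have "norm (grad_theta f \<theta>1 ?z1 - grad_theta f \<theta>2 ?z2)
      \<le> norm (grad_theta f \<theta>1 ?z1 - grad_theta f \<theta>2 ?z1)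
        + norm (grad_theta f \<theta>2 ?z1 - grad_theta f \<theta>2 ?z2)"
    by (metis diff_add_cancel add_diff_eq norm_triangle_ineq)
  also have "\<dots> \<le> L\<theta>\<theta> * norm (\<theta>1 - \<theta>2) + L\<theta>z * norm (?z1 - ?z2)"
    by (intro add_mono lip_theta_theta lip_theta_z)
  also have "L\<theta>z * norm (?z1 - ?z2) \<le> L\<theta>z * (Lz\<theta> / (lam - Lzz) * norm (\<theta>1 - \<theta>2))"
    by (intro mult_left_mono z_star_lipschitz lipschitz_const_nonneg[OF lip_theta_z])
  finally show ?thesis by (simp add: algebra_simps)
qed

text \<open>Danskin's formula for the gradient of \<open>robust_loss\<close>: the maximizers are
  held fixed while differentiating.\<close>

definition robust_grad :: "(nat \<Rightarrow> 'b) \<Rightarrow> nat \<Rightarrow> 'a \<Rightarrow> 'a" where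
  "robust_grad x N \<theta> =
     (1 / real N) *\<^sub>R (\<Sum>j=1..N. grad_theta f \<theta> (z_star f c lam \<theta> (x j)))"

lemma robust_grad_lipschitz:
  assumes "1 \<le> N"
  shows "norm (robust_grad x N \<theta>1 - robust_grad x N \<theta>2)
     \<le> (L\<theta>\<theta> + L\<theta>z * Lz\<theta> / (lam - Lzz)) * norm (\<theta>1 - \<theta>2)" (is "_ \<le> ?b")
proof -
  let ?d = "\<lambda>j. grad_theta f \<theta>1 (z_star f c lam \<theta>1 (x j)) - grad_theta f \<theta>2 (z_star f c lam \<theta>2 (x j))"
  have "norm (robust_grad x N \<theta>1 - robust_grad x N \<theta>2) = (1 / real N) * norm (\<Sum>j=1..N. ?d j)"
    by (simp add: robust_grad_def sum_subtractf flip: scaleR_diff_right)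
  also have "\<dots> \<le> (1 / real N) * (\<Sum>j=1..N. ?b)"
    by (intro mult_left_mono sum_norm_le grad_at_z_star_lipschitz) auto
  also have "\<dots> = ?b" using assms by simp
  finally show ?thesis .
qed

text \<open>The maximizer at \<open>\<theta>\<close> is a competitor in the supremum at \<open>\<theta>'\<close>, so convexity of \<open>f\<close> in its first
  argument alone yields a subgradient; no envelope theorem is needed.\<close>

lemma robust_loss_subgradient:
  assumes f_convex: "\<And>z. convex_on UNIV (\<lambda>\<theta>. f \<theta> z)"
  shows "robust_loss f c lam x N \<theta> + robust_grad x N \<theta> \<bullet> (\<theta>' - \<theta>) \<le> robust_loss f c lam x N \<theta>'"
proof -
  have sub: "phi f c lam \<theta> w + grad_theta f \<theta> (z_star f c lam \<theta> w) \<bullet> (\<theta>' - \<theta>) \<le> phi f c lam \<theta>' w" for w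
  proof -
    let ?z = "z_star f c lam \<theta> w"
    have "f \<theta> ?z + grad_theta f \<theta> ?z \<bullet> (\<theta>' - \<theta>) \<le> f \<theta>' ?z"
      using strongly_convex_gradient_ineq[OF convex_on_imp_strongly_convex_0[OF f_convex] gderiv_grad_theta]
      by simp
    with z_star_max[of \<theta>' ?z w] show ?thesis by (simp add: phi_eq_z_star)
  qed
  have "robust_loss f c lam x N \<theta> + robust_grad x N \<theta> \<bullet> (\<theta>' - \<theta>) = (1 / real N) *
      (\<Sum>j=1..N. phi f c lam \<theta> (x j) + grad_theta f \<theta> (z_star f c lam \<theta> (x j)) \<bullet> (\<theta>' - \<theta>))"
    by (simp add: robust_loss_def robust_grad_def inner_sum_left sum.distrib distrib_left)
  also have "\<dots> \<le> robust_loss f c lam x N \<theta>'"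
    unfolding robust_loss_def by (intro mult_left_mono sum_mono sub) simp
  finally show ?thesis .
qed

lemma robust_loss_descent:
  assumes "\<And>z. convex_on UNIV (\<lambda>\<theta>. f \<theta> z)" and "1 \<le> N"
  shows "robust_loss f c lam x N \<theta>' \<le> robust_loss f c lam x N \<theta> + robust_grad x N \<theta> \<bullet> (\<theta>' - \<theta>)
    + (L\<theta>\<theta> + L\<theta>z * Lz\<theta> / (lam - Lzz)) / 2 * (norm (\<theta>' - \<theta>))\<^sup>2"
  by (rule descent_lemma[OF gderiv_lipschitz_subgradient[OF robust_loss_subgradient robust_grad_lipschitz]
        robust_grad_lipschitz]) (use assms in auto)

end

section \<open>One inexact gradient step, and averages over samples\<close>

lemma inexact_gradient_step:
  fixes h :: "'a::real_inner \<Rightarrow> real"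
  assumes "h (\<theta> - (1 / L) *\<^sub>R G) \<le> h \<theta> + v \<bullet> (\<theta> - (1 / L) *\<^sub>R G - \<theta>)
      + L / 2 * (norm (\<theta> - (1 / L) *\<^sub>R G - \<theta>))\<^sup>2"
    and "0 < L"
  shows "h (\<theta> - (1 / L) *\<^sub>R G) \<le> h \<theta> - (norm v)\<^sup>2 / (2 * L) + (norm (G - v))\<^sup>2 / (2 * L)"
proof -
  \<comment> \<open>Step size \<open>1 / L\<close> matches the weights of the linear and quadratic
    terms, so completing the square removes \<open>v \<bullet> G\<close> with no loss.\<close>
  have "(norm (G - v))\<^sup>2 = (norm G)\<^sup>2 - 2 * (v \<bullet> G) + (norm v)\<^sup>2"
    unfolding power2_norm_eq_inner by (simp add: inner_diff inner_commute)
  then have "v \<bullet> (- (1 / L) *\<^sub>R G) + L / 2 * (norm ((1 / L) *\<^sub>R G))\<^sup>2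
      = - (norm v)\<^sup>2 / (2 * L) + (norm (G - v))\<^sup>2 / (2 * L)"
    using \<open>0 < L\<close> by (simp add: field_simps power2_eq_square)
  with assms(1) show ?thesis by simp
qed

text \<open>The gap is a perfect square over \<open>r\<close>. The parameter trades the error
  proportional to the gradient against the constant error.\<close>

lemma square_sum_young:
  fixes a b r :: real
  assumes "0 < r"
  shows "(a + b)\<^sup>2 \<le> (1 + r) * a\<^sup>2 + (1 + 1 / r) * b\<^sup>2"
proof -
  have "(1 + r) * a\<^sup>2 + (1 + 1 / r) * b\<^sup>2 - (a + b)\<^sup>2 = (r * a - b)\<^sup>2 / r"
    using assms by (simp add: field_simps power2_eq_square)
  moreover have "0 \<le> (r * a - b)\<^sup>2 / r" using assms by simp
  ultimately show ?thesis by linarith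
qed

lemma samples_subset:
  assumes "i \<in> {1..m}"
  shows "samples n i \<subseteq> {1..m * n}"
proof -
  \<comment> \<open>Workers are numbered from 1, so the natural subtraction does not
    truncate.\<close>
  have "(i - 1) * n + n = i * n" using assms by (cases i) auto
  also have "\<dots> \<le> m * n" using assms by simp
  finally show ?thesis by (auto simp: samples_def)
qed

lemma norm_average_diff_le:
  fixes u :: "'i \<Rightarrow> 'a::real_normed_vector"
  assumes "card S = n" "1 \<le> n" and "\<And>j. j \<in> S \<Longrightarrow> norm (u j - v) \<le> \<delta>"
  shows "norm ((1 / real n) *\<^sub>R (\<Sum>j\<in>S. u j) - v) \<le> \<delta>"
proof -
  have "(1 / real n) *\<^sub>R (\<Sum>j\<in>S. u j) - v = (1 / real n) *\<^sub>R (\<Sum>j\<in>S. u j - v)"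
    using assms(1,2)
    by (simp add: sum_subtractf scaleR_diff_right sum_constant_scaleR del: sum_constant)
  then have "norm ((1 / real n) *\<^sub>R (\<Sum>j\<in>S. u j) - v) = (1 / real n) * norm (\<Sum>j\<in>S. u j - v)"
    by simp
  also have "\<dots> \<le> (1 / real n) * (\<Sum>j\<in>S. \<delta>)"
    by (intro mult_left_mono sum_norm_le assms) auto
  also have "\<dots> = \<delta>" using assms(1,2) by simp
  finally show ?thesis .
qed

section \<open>Convergence under byzantine messages\<close>

theorem theorem3:
  fixes f :: "real^'p \<Rightarrow> real^'d \<Rightarrow> real"
    and c :: "real^'d \<Rightarrow> real^'d \<Rightarrow> real"
    and x :: "nat \<Rightarrow> real^'d"
    and m n T :: nat
    and B M :: "nat set"
    and lam \<alpha> \<beta> \<epsilon> \<sigma> k r :: real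
    and L\<theta>\<theta> L\<theta>z Lz\<theta> Lzz Lc LF C\<alpha> D :: real
    and ze :: "nat \<Rightarrow> nat \<Rightarrow> real^'d"
    and g :: "nat \<Rightarrow> nat \<Rightarrow> real^'p"
    and \<theta> :: "nat \<Rightarrow> real^'p"
    and \<theta>star :: "real^'p"
  defines "F \<equiv> robust_loss f c lam x (m * n)"
  assumes sizes: "m \<ge> 1" "n \<ge> 1" "T \<ge> 1"
    and params: "lam \<ge> 0" "\<alpha> \<ge> 0" "\<alpha> \<le> \<beta>" "\<beta> < 1" "\<epsilon> \<ge> 0"
    and workers: "B \<union> M = {1..m}" "B \<inter> M = {}"
      "real (card B) = \<alpha> * real m" "real (card M) = (1 - \<alpha>) * real m"
    and screen_int: "(1 - \<beta>) * real m \<in> \<int>"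
    and f_diff: "\<And>\<theta> z. (\<lambda>(\<theta>, z). f \<theta> z) differentiable at (\<theta>, z)"
    and lip_theta_theta: "\<And>\<theta>1 \<theta>2 z.
      norm (grad_theta f \<theta>1 z - grad_theta f \<theta>2 z) \<le> L\<theta>\<theta> * norm (\<theta>1 - \<theta>2)"
    and lip_theta_z: "\<And>\<theta> z1 z2.
      norm (grad_theta f \<theta> z1 - grad_theta f \<theta> z2) \<le> L\<theta>z * norm (z1 - z2)"
    and lip_z_theta: "\<And>\<theta>1 \<theta>2 z.
      norm (grad_z f \<theta>1 z - grad_z f \<theta>2 z) \<le> Lz\<theta> * norm (\<theta>1 - \<theta>2)"
    and lip_z_z: "\<And>\<theta> z1 z2.
      norm (grad_z f \<theta> z1 - grad_z f \<theta> z2) \<le> Lzz * norm (z1 - z2)"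
    and cost_smooth: "\<And>y. smooth_with Lc (\<lambda>z. c z y)"
    and cost_strongly_convex: "\<And>y. strongly_convex 1 (\<lambda>z. c z y)"
    and lam_large: "lam > Lzz"
    and heterogeneity: "\<And>t. t < T \<Longrightarrow>
      (MAX l\<in>{1..m * n}. norm (grad_theta f (\<theta> t) (z_star f c lam (\<theta> t) (x l))
         - (1 / real (m * n)) *\<^sub>R (\<Sum>j=1..m * n. grad_theta f (\<theta> t) (z_star f c lam (\<theta> t) (x j)))))
      \<le> \<sigma>"
    and f_convex: "\<And>z. convex_on UNIV (\<lambda>\<theta>. f \<theta> z)"
    and minimizer: "\<And>\<theta>'. F \<theta>star \<le> F \<theta>'"
    and bounded_iterates: "\<And>t. t < T \<Longrightarrow> norm (\<theta> t - \<theta>star) \<le> k * norm (\<theta> 0 - \<theta>star)"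
    and LF_eq: "LF = L\<theta>\<theta> + L\<theta>z * Lz\<theta> / (lam - Lzz)"
    and LF_pos: "LF > 0"
    and C_eq: "C\<alpha> = 2 * \<alpha> / (1 - \<beta>)"
    and D_eq: "D = k * norm (\<theta> 0 - \<theta>star)"
    and alpha_less: "\<alpha> < 1 / 3"
    and run: "algorithm_A_run f c lam x m n M \<beta> (1 / LF) \<epsilon> T ze g \<theta>"
    and r_range: "0 < r" "\<alpha> > 0 \<Longrightarrow> r < ((1 - \<beta>) / (2 * \<alpha>))\<^sup>2 - 1"
  shows "F (\<theta> T) - F \<theta>star \<le>
    max (4 * LF * D\<^sup>2 / ((1 - (1 + r) * C\<alpha>\<^sup>2) * real T))
        (sqrt (2 * (1 + 1 / r) / (1 - (1 + r) * C\<alpha>\<^sup>2)) * D * (L\<theta>z * \<epsilon> + \<sigma>)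
          + (1 + 1 / r) * (L\<theta>z * \<epsilon> + \<sigma>)\<^sup>2 / (2 * LF))"
proof -
  define N where "N = m * n"
  have N: "1 \<le> N" using sizes unfolding N_def by simp
  define V where "V = robust_grad f c lam x N"
  define \<delta> where "\<delta> = L\<theta>z * \<epsilon> + \<sigma>"
  define q where "q = 1 - (1 + r) * C\<alpha>\<^sup>2"
  note problem = f_diff lip_theta_theta lip_theta_z lip_z_theta lip_z_z cost_smooth
    cost_strongly_convex lam_large
  have F: "F = robust_loss f c lam x N" by (simp add: F_def N_def)
  have V: "V \<theta>' = (1 / real N) *\<^sub>R (\<Sum>j=1..N. grad_theta f \<theta>' (z_star f c lam \<theta>' (x j)))" for \<theta>'
    unfolding V_def by (rule robust_grad_def[OF problem])
  have descent: "F \<theta>2 \<le> F \<theta>1 + V \<theta>1 \<bullet> (\<theta>2 - \<theta>1) + LF / 2 * (norm (\<theta>2 - \<theta>1))\<^sup>2" for \<theta>1 \<theta>2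
    unfolding F V_def LF_eq by (rule robust_loss_descent[OF problem f_convex N])
  have subgrad: "F \<theta>1 + V \<theta>1 \<bullet> (\<theta>2 - \<theta>1) \<le> F \<theta>2" for \<theta>1 \<theta>2
    unfolding F V_def by (rule robust_loss_subgradient[OF problem f_convex])
  have L\<theta>z: "0 \<le> L\<theta>z" by (rule lipschitz_const_nonneg[OF lip_theta_z])
  have hetero: "norm (grad_theta f (\<theta> t) (z_star f c lam (\<theta> t) (x j)) - V (\<theta> t)) \<le> \<sigma>"
    if "t < T" "j \<in> {1..N}" for t j
    using heterogeneity[OF \<open>t < T\<close>] that(2) N unfolding V N_def
    by (subst (asm) Max_le_iff) auto
  \<comment> \<open>The sign of \<open>\<sigma>\<close> is read off from iteration 0 and sample 1,
    which exist because \<open>T\<close> and \<open>N\<close> are positive.\<close>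
  have "0 \<le> norm (grad_theta f (\<theta> 0) (z_star f c lam (\<theta> 0) (x 1)) - V (\<theta> 0))" by simp
  also have "\<dots> \<le> \<sigma>" using sizes N by (intro hetero) auto
  finally have "0 \<le> \<delta>" using L\<theta>z params by (simp add: \<delta>_def)
  have C: "0 \<le> C\<alpha>" using params by (simp add: C_eq)
  \<comment> \<open>The upper bound on \<open>r\<close> says exactly that
    \<open>(1 + r) * C\<alpha>\<^sup>2 < 1\<close>; for \<open>\<alpha> = 0\<close> the constant
    \<open>C\<alpha>\<close> vanishes and \<open>q = 1\<close>.\<close>
  have "0 < q"
  proof (cases "\<alpha> = 0")
    case False
    then have "0 < \<alpha>" using params by simp
    then have "1 + r < ((1 - \<beta>) / (2 * \<alpha>))\<^sup>2" using r_range(2) by simp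
    then have "(1 + r) * C\<alpha>\<^sup>2 < ((1 - \<beta>) / (2 * \<alpha>))\<^sup>2 * C\<alpha>\<^sup>2"
      using \<open>0 < \<alpha>\<close> params by (intro mult_strict_right_mono) (auto simp: C_eq)
    also have "\<dots> = ((1 - \<beta>) / (2 * \<alpha>) * C\<alpha>)\<^sup>2" by (rule power_mult_distrib[symmetric])
    also have "\<dots> = 1" using \<open>0 < \<alpha>\<close> params by (simp add: C_eq)
    finally show ?thesis by (simp add: q_def)
  qed (simp add: q_def C_eq)
  have deviation: "norm (G - V (\<theta> t)) \<le> C\<alpha> * norm (V (\<theta> t)) + \<delta>"
    if "t < T" and screen: "norm_screen \<beta> m (g t) G" for t G
    unfolding C_eq
  proof (rule norm_screen_deviation[OF screen sizes(1) params(2-4) screen_int workers])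
    fix i assume "i \<in> M"
    then have i: "i \<in> {1..m}" using workers(1) by blast
    have g: "g t i = (1 / real n) *\<^sub>R (\<Sum>j\<in>samples n i. grad_theta f (\<theta> t) (ze t j))"
      and ze: "\<And>j. j \<in> samples n i \<Longrightarrow> norm (ze t j - z_star f c lam (\<theta> t) (x j)) \<le> \<epsilon>"
      using run \<open>t < T\<close> \<open>i \<in> M\<close> unfolding algorithm_A_run_def by blast+
    show "norm (g t i - V (\<theta> t)) \<le> \<delta>"
      unfolding g
    proof (rule norm_average_diff_le)
      fix j assume j: "j \<in> samples n i"
      let ?z = "z_star f c lam (\<theta> t) (x j)"
      \<comment> \<open>Passing through the exact maximizer separates the inner precision from the
        heterogeneity of the data.\<close>
      have "norm (grad_theta f (\<theta> t) (ze t j) - V (\<theta> t))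
          \<le> norm (grad_theta f (\<theta> t) (ze t j) - grad_theta f (\<theta> t) ?z)
            + norm (grad_theta f (\<theta> t) ?z - V (\<theta> t))"
        by (metis diff_add_cancel add_diff_eq norm_triangle_ineq)
      also have "\<dots> \<le> L\<theta>z * norm (ze t j - ?z) + \<sigma>"
        using subsetD[OF samples_subset[OF i] j] \<open>t < T\<close>
        by (intro add_mono lip_theta_z hetero) (auto simp: N_def)
      also have "\<dots> \<le> \<delta>"
        unfolding \<delta>_def by (intro add_right_mono mult_left_mono ze[OF j] L\<theta>z)
      finally show "norm (grad_theta f (\<theta> t) (ze t j) - V (\<theta> t)) \<le> \<delta>" .
    qed (use sizes in \<open>auto simp: samples_def\<close>)
  qed (rule \<open>0 \<le> \<delta>\<close>)
  define u where "u t = F (\<theta> t) - F \<theta>star" for t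
  define e where "e = (1 + 1 / r) * \<delta>\<^sup>2 / (2 * LF)"
  have "0 \<le> e" using r_range LF_pos by (simp add: e_def)
  have u_nonneg: "0 \<le> u t" for t using minimizer by (simp add: u_def)
  have step: "u (Suc t) \<le> u t - q / (2 * LF) * (norm (V (\<theta> t)))\<^sup>2 + e" if "t < T" for t
  proof -
    let ?v = "norm (V (\<theta> t))"
    obtain G where G: "norm_screen \<beta> m (g t) G" and next_\<theta>: "\<theta> (Suc t) = \<theta> t - (1 / LF) *\<^sub>R G"
      using run \<open>t < T\<close> unfolding algorithm_A_run_def by blast
    have "(norm (G - V (\<theta> t)))\<^sup>2 \<le> (C\<alpha> * ?v + \<delta>)\<^sup>2"
      using deviation[OF \<open>t < T\<close> G] by (intro power_mono) auto
    \<comment> \<open>The part proportional to \<open>?v\<close> is absorbed by the descent term,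
      leaving the factor \<open>q\<close>; the constant part becomes \<open>e\<close>.\<close>
    also have "\<dots> \<le> (1 + r) * (C\<alpha> * ?v)\<^sup>2 + (1 + 1 / r) * \<delta>\<^sup>2"
      by (rule square_sum_young) (rule r_range)
    finally have "(norm (G - V (\<theta> t)))\<^sup>2 / (2 * LF)
        \<le> ((1 + r) * (C\<alpha> * ?v)\<^sup>2 + (1 + 1 / r) * \<delta>\<^sup>2) / (2 * LF)"
      using LF_pos by (intro divide_right_mono) auto
    moreover have "F (\<theta> (Suc t))
        \<le> F (\<theta> t) - ?v\<^sup>2 / (2 * LF) + (norm (G - V (\<theta> t)))\<^sup>2 / (2 * LF)"
      unfolding next_\<theta> by (rule inexact_gradient_step[OF descent LF_pos])
    moreover have "?v\<^sup>2 / (2 * LF) - ((1 + r) * (C\<alpha> * ?v)\<^sup>2 + (1 + 1 / r) * \<delta>\<^sup>2) / (2 * LF)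
        = q / (2 * LF) * ?v\<^sup>2 - e"
      using LF_pos by (simp add: q_def e_def field_simps)
    ultimately show ?thesis unfolding u_def by linarith
  qed
  have u_le: "u t \<le> D * norm (V (\<theta> t))" if "t < T" for t
  proof -
    have "u t \<le> V (\<theta> t) \<bullet> (\<theta> t - \<theta>star)"
      using subgrad[of "\<theta> t" \<theta>star] by (simp add: u_def inner_diff_right)
    also have "\<dots> \<le> norm (V (\<theta> t)) * norm (\<theta> t - \<theta>star)" by (rule norm_cauchy_schwarz)
    also have "\<dots> \<le> norm (V (\<theta> t)) * D"
      using bounded_iterates[OF \<open>t < T\<close>] by (intro mult_left_mono) (auto simp: D_eq)
    finally show ?thesis by (simp add: mult.commute)
  qed
  \<comment> \<open>The sign of \<open>D\<close> follows from the bound on the iterates at time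
    0.\<close>
  have "0 \<le> norm (\<theta> 0 - \<theta>star)" by simp
  also have "\<dots> \<le> D" using bounded_iterates[of 0] sizes by (simp add: D_eq)
  finally have "0 \<le> D" .
  \<comment> \<open>Chosen to solve \<open>a * s\<^sup>2 = 2 * e\<close> for the rate
    \<open>a = q / (2 * LF * D\<^sup>2)\<close> introduced below.\<close>
  define s where "s = sqrt (2 * (1 + 1 / r) / q) * D * \<delta>"
  have "0 \<le> s" using \<open>0 \<le> D\<close> \<open>0 \<le> \<delta>\<close> \<open>0 < q\<close> r_range by (simp add: s_def)
  have "u T \<le> max (4 * LF * D\<^sup>2 / (q * real T)) (s + e)"
  \<comment> \<open>For \<open>D = 0\<close> the rate \<open>a\<close> degenerates, but
    \<open>u (T - 1) \<le> 0\<close> and the last step alone yields at most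
    \<open>e\<close>.\<close>
  proof (cases "D = 0")
    case True
    have "T - 1 < T" "Suc (T - 1) = T" using sizes by auto
    moreover have "u (T - 1) \<le> 0" using u_le[of "T - 1"] True sizes by simp
    moreover have "0 \<le> q / (2 * LF) * (norm (V (\<theta> (T - 1))))\<^sup>2"
      using \<open>0 < q\<close> LF_pos by simp
    ultimately have "u T \<le> e" using step[of "T - 1"] by simp
    with \<open>0 \<le> s\<close> show ?thesis by simp
  next
    case False
    then have "0 < D" using \<open>0 \<le> D\<close> by simp
    \<comment> \<open>The descent coefficient \<open>q / (2 * LF)\<close> after bounding the
      gradient norm below by \<open>u t / D\<close>.\<close>
    define a where "a = q / (2 * LF * D\<^sup>2)"
    have "u T \<le> max (2 / (a * real T)) (s + e)"
    proof (rule perturbed_quadratic_recursion)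
      fix t assume "t < T"
      have "(u t)\<^sup>2 \<le> (D * norm (V (\<theta> t)))\<^sup>2"
        using u_le[OF \<open>t < T\<close>] u_nonneg by (intro power_mono)
      then have "a * (u t)\<^sup>2 \<le> a * (D * norm (V (\<theta> t)))\<^sup>2"
        using \<open>0 < q\<close> LF_pos by (intro mult_left_mono) (auto simp: a_def)
      also have "\<dots> = q / (2 * LF) * (norm (V (\<theta> t)))\<^sup>2"
        using \<open>0 < D\<close> by (simp add: a_def power_mult_distrib)
      finally show "u (Suc t) \<le> u t - a * (u t)\<^sup>2 + e" using step[OF \<open>t < T\<close>] by linarith
    next
      define \<rho> where "\<rho> = 1 + 1 / r"
      have "s\<^sup>2 = 2 * \<rho> / q * D\<^sup>2 * \<delta>\<^sup>2"
        using \<open>0 < q\<close> r_range by (simp add: s_def \<rho>_def power_mult_distrib)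
      then show "a * s\<^sup>2 = 2 * e"
        using \<open>0 < q\<close> \<open>0 < D\<close> LF_pos by (simp add: a_def e_def flip: \<rho>_def)
    qed (use sizes \<open>0 < q\<close> \<open>0 < D\<close> LF_pos \<open>0 \<le> e\<close> \<open>0 \<le> s\<close> in \<open>auto simp: a_def\<close>)
    also have "2 / (a * real T) = 4 * LF * D\<^sup>2 / (q * real T)"
      by (simp add: a_def)
    finally show ?thesis .
  qed
  then show ?thesis by (simp add: u_def s_def e_def q_def \<delta>_def)
qed

end
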